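(* Let $\varepsilon\in\{1,-1\}$, let $$L=q^{-k}(1+q^{k+1})[k+2]\,\sigma^2+\varepsilon\,(q+q^{k+2}+q^{2k+4}+3q^{k+3})[-2k-3]\,\sigma+q^{-k}(1+q^{k+2})[k+1],$$ and let $n$ be a positive integer. For any $p(x)\in\mathbb{Z}[q,q^{-1}][x,x^{-1}]$, we have $$\sum_{k=0}^{n-1}L^{\ast}(p([k]))\,\varepsilon^kD_k(q)\equiv0\pmod{[n]}.$$
   Context: $q$ is an indeterminate, $\sigma$ is the shift operator in $k$ (so $\sigma^iF_k=F_{k+i}$ for $i\in\mathbb{Z}$), and $[m]=\frac{1-q^m}{1-q}$ for $m\in\mathbb{Z}$. The expression $p([k])$ is $p(x)$ with $x$ replaced by the $q$-integer $[k]$. For an operator $L=\sum_{i=0}^{J}a_i(q^k)\sigma^i$ whose coefficients are Laurent polynomials in $q^k$ over a field $\mathbb{K}(q)$, with $\mathbb{K}$ of characteristic zero, the adjoint is $L^{\ast}=\sum_{i=0}^{J}a_i(q^{k-i})\sigma^{-i}$, so that $L^{\ast}(p([k]))=\sum_{i=0}^{J}a_i(q^{k-i})\,p([k-i])$. The $q$-binomial coefficient is $\left[\begin{matrix}m\\ k\end{matrix}\right]=\frac{\prod_{1\le j\le k}[m-j+1]}{\prod_{1\le j\le k}[j]}$ for integers $m\ge0$ and $k\ge1$, with $\left[\begin{matrix}m\\0\end{matrix}\right]=1$. The $q$-central Delannoy numbers are $D_n(q)=\sum_{k=0}^{n}q^{\binom{k}{2}-kn}\left[\begin{matrix}n\\k\end{matrix}\right]\left[\begin{matrix}n+k\\k\end{matrix}\right]\in\mathbb{Z}[q,q^{-1}]$.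 The congruence means divisibility by $[n]$ in $\mathbb{Z}[q,q^{-1}]$.
   Formalization: The formal statement requires p([k-i]) to be defined for 0≤k<n, 0≤i≤2; since the k=0 term contains (1+q^2)p([0]) with [0]=0, this means p(x) has no negative powers of x, i.e. p∈Z[q,q^{-1}][x]; otherwise the sum is undefined. *)

theory Defs
  imports "HOL-Library.Poly_Mapping" "HOL-Computational_Algebra.Polynomial_Factorial"
begin

text \<open>Everything takes place in the field of rational functions in \<open>q\<close>, realised as the
  fraction field of the integer polynomials.\<close>

type_synonym ratfun = "int poly fract"

definition q :: ratfun where
  "q = to_fract [:0, 1:]"

text \<open>The subring of integer Laurent polynomials in \<open>q\<close>.\<close>

definition Laurent_q :: "ratfun set" where
  "Laurent_q = {to_fract P / q ^ m | (P :: int poly) (m :: nat). True}"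

definition laurent_cong :: "ratfun \<Rightarrow> ratfun \<Rightarrow> ratfun \<Rightarrow> bool" where
  "laurent_cong a b m \<longleftrightarrow> (\<exists>c\<in>Laurent_q. a - b = m * c)"

definition qint :: "int \<Rightarrow> ratfun" where
  "qint m = (1 - q powi m) / (1 - q)"

definition qbinom :: "nat \<Rightarrow> nat \<Rightarrow> ratfun" where
  "qbinom m k = (\<Prod>j=1..k. qint (int m - int j + 1)) / (\<Prod>j=1..k. qint (int j))"

definition delannoy :: "nat \<Rightarrow> ratfun" where
  "delannoy n = (\<Sum>k=0..n. q powi (int (k choose 2) - int k * int n) * qbinom n k * qbinom (n + k) k)"

text \<open>A Laurent polynomial in \<open>x\<close> is a finitely supported map from integer exponents to
  coefficients. Since \<open>0 powi i = 0\<close> for negative \<open>i\<close>, the value of \<open>laurent_eval\<close> is meaningful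
  only where \<open>laurent_defined_at\<close> holds: a Laurent polynomial with an actual negative power of
  \<open>x\<close> has no value at \<open>0\<close>.\<close>

definition laurent_eval :: "(int \<Rightarrow>\<^sub>0 'a::field) \<Rightarrow> 'a \<Rightarrow> 'a" where
  "laurent_eval p x = (\<Sum>i\<in>Poly_Mapping.keys p. Poly_Mapping.lookup p i * x powi i)"

definition laurent_defined_at :: "(int \<Rightarrow>\<^sub>0 'a::field) \<Rightarrow> 'a \<Rightarrow> bool" where
  "laurent_defined_at p x \<longleftrightarrow> x \<noteq> 0 \<or> (\<forall>i\<in>Poly_Mapping.keys p. 0 \<le> i)"

text \<open>An operator is the list of its coefficients at \<open>\<sigma>\<^sup>0, \<sigma>\<^sup>1, \<dots>\<close>; the coefficient \<open>a(q\<^sup>k)\<close> is given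
  as a function of \<open>k\<close>, so that \<open>a(q\<^bsup>k-i\<^esup>)\<close> is its value at \<open>k - i\<close>.\<close>

type_synonym shift_operator = "(int \<Rightarrow> ratfun) list"

definition adjoint_apply :: "shift_operator \<Rightarrow> (int \<Rightarrow> ratfun) \<Rightarrow> int \<Rightarrow> ratfun" where
  "adjoint_apply L F k = (\<Sum>i<length L. (L ! i) (k - int i) * F (k - int i))"

definition delannoy_operator :: "ratfun \<Rightarrow> shift_operator" where
  "delannoy_operator \<epsilon> =
    [\<lambda>k. q powi (-k) * (1 + q powi (k + 2)) * qint (k + 1),
     \<lambda>k. \<epsilon> * (q + q powi (k + 2) + q powi (2 * k + 4) + 3 * q powi (k + 3)) * qint (- 2 * k - 3),
     \<lambda>k. q powi (-k) * (1 + q powi (k + 1)) * qint (k + 2)]"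

end

theory Submission
  imports Defs
begin

text \<open>The sequence \<open>F\<^sub>k = \<epsilon>\<^sup>k D\<^sub>k(q)\<close> is annihilated by the operator \<open>L\<close>. Hence summation by parts
  moves \<open>L\<^sup>*\<close> from the test function onto \<open>F\<close>, where it gives zero, and the sum collapses to
  boundary terms. At the lower end these cancel, because \<open>L F = 0\<close> persists at \<open>k = -1\<close>, where the
  factor \<open>[k+1]\<close> removes the term with \<open>F\<^bsub>-1\<^esub>\<close>, and because the coefficient of \<open>\<sigma>\<^sup>2\<close>,
  a multiple of \<open>[k+2]\<close>, vanishes at \<open>k = -2\<close>.
  At the upper end, one use of \<open>L F = 0\<close> at \<open>k = n - 1\<close> leaves two terms, with the coefficient of \<open>\<sigma>\<^sup>0\<close>
  at \<open>n - 1\<close> and that of \<open>\<sigma>\<^sup>2\<close> at \<open>n - 2\<close>; both carry the factor \<open>[n]\<close>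
  (\<open>sum_adjoint_apply\<close>). The cofactors are Laurent polynomials: the Gaussian binomials are, by
  q-Pascal (\<open>Laurent_q_qbinom\<close>), and the test function \<open>p\<close>, having a value at \<open>[0] = 0\<close>, involves
  no negative power of \<open>x\<close>.

  The relation \<open>L F = 0\<close> (\<open>delannoy_recurrence\<close>) is found by creative telescoping. With \<open>t(n,k)\<close> the
  summand of \<open>D\<^sub>n\<close>, the corresponding combination of \<open>t(n+2,k)\<close>, \<open>t(n+1,k)\<close> and \<open>t(n,k)\<close> equals
  \<open>c (t(n+1,k) - t(n+1,k-1))\<close> for some \<open>c\<close> that depends on \<open>n\<close> only
  (\<open>delannoy_term_telescope\<close>), and the right-hand side sums to zero over all \<open>k\<close>.\<close>

section \<open>Integer Laurent polynomials\<close>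

lemma q_power: "q ^ m = to_fract (monom 1 m)"
  by (induction m) (simp_all add: q_def monom_0 monom_Suc one_pCons[symmetric] flip: to_fract_mult)

lemma q_nonzero [simp]: "q \<noteq> 0"
  by (simp add: q_def to_fract_eq_0_iff)

text \<open>The indeterminate is not a root of unity, so positive q-integers are invertible.\<close>

lemma q_power_neq_1: "m > 0 \<Longrightarrow> q ^ m \<noteq> 1"
proof
  assume "m > 0" "q ^ m = 1"
  then have "to_fract (monom (1::int) m) = to_fract 1"
    by (simp add: q_power)
  then have "monom (1::int) m = 1"
    by (simp only: to_fract_eq_iff)
  then have "degree (monom (1::int) m) = 0"
    by simp
  with \<open>m > 0\<close> show False
    by (simp add: degree_monom_eq)
qed

lemma q_neq_1 [simp]: "q \<noteq> 1" "1 \<noteq> q"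
  using q_power_neq_1[of 1] by auto

lemma Laurent_q_I: "to_fract P / q ^ m \<in> Laurent_q"
  by (auto simp: Laurent_q_def)

lemma Laurent_q_to_fract: "to_fract P \<in> Laurent_q"
  using Laurent_q_I[of P 0] by simp

lemma Laurent_q_0 [simp]: "0 \<in> Laurent_q"
  using Laurent_q_to_fract[of 0] by simp

lemma Laurent_q_1 [simp]: "1 \<in> Laurent_q"
  using Laurent_q_to_fract[of 1] by simp

lemma Laurent_q_uminus: "a \<in> Laurent_q \<Longrightarrow> - a \<in> Laurent_q"
  unfolding Laurent_q_def by clarsimp (metis minus_divide_left to_fract_uminus)

lemma Laurent_q_mult: "a \<in> Laurent_q \<Longrightarrow> b \<in> Laurent_q \<Longrightarrow> a * b \<in> Laurent_q"
  unfolding Laurent_q_def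
  by clarsimp (metis power_add times_divide_times_eq to_fract_mult)

lemma Laurent_q_add:
  assumes "a \<in> Laurent_q" "b \<in> Laurent_q"
  shows "a + b \<in> Laurent_q"
proof -
  obtain P m R l where eq: "a = to_fract P / q ^ m" "b = to_fract R / q ^ l"
    using assms by (auto simp: Laurent_q_def)
  have "a + b = to_fract (P * monom 1 l + R * monom 1 m) / q ^ (m + l)"
    by (simp add: eq q_power[symmetric] field_simps power_add)
  then show ?thesis
    by (simp only: Laurent_q_I)
qed

lemma Laurent_q_sum: "(\<And>i. i \<in> A \<Longrightarrow> f i \<in> Laurent_q) \<Longrightarrow> sum f A \<in> Laurent_q"
  by (induction A rule: infinite_finite_induct) (auto intro: Laurent_q_add)

lemma Laurent_q_power: "a \<in> Laurent_q \<Longrightarrow> a ^ m \<in> Laurent_q"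
  by (induction m) (auto intro: Laurent_q_mult)

lemma Laurent_q_powi_q: "q powi m \<in> Laurent_q"
proof (cases "m \<ge> 0")
  case True
  then show ?thesis
    using Laurent_q_to_fract[of "monom 1 (nat m)"] by (simp add: power_int_def q_power)
next
  case False
  then show ?thesis
    using Laurent_q_I[of 1 "nat (- m)"] by (simp add: power_int_def divide_inverse power_inverse)
qed

lemma qint_of_nat: "qint (int m) = (\<Sum>i<m. q ^ i)"
  by (simp add: qint_def sum_gp_strict)

lemma qint_neg: "qint (- m) = - (q powi (- m) * qint m)"
proof -
  have "1 - q powi (- m) = - (q powi (- m) * (1 - q powi m))"
    by (simp add: algebra_simps flip: power_int_add)
  then show ?thesis
    by (simp add: qint_def)
qed

lemma Laurent_q_qint: "qint m \<in> Laurent_q"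
proof -
  have pos: "qint (int l) \<in> Laurent_q" for l
    unfolding qint_of_nat using Laurent_q_powi_q[of "int _"] by (intro Laurent_q_sum) simp
  show ?thesis
  proof (cases "m \<ge> 0")
    case True
    then show ?thesis
      using pos[of "nat m"] by simp
  next
    case False
    then have "qint m = - (q powi m * qint (int (nat (- m))))"
      using qint_neg[of "- m"] by simp
    also have "\<dots> \<in> Laurent_q"
      by (intro Laurent_q_uminus Laurent_q_mult Laurent_q_powi_q pos)
    finally show ?thesis .
  qed
qed

lemmas Laurent_q_intros =
  Laurent_q_add Laurent_q_mult Laurent_q_uminus Laurent_q_powi_q Laurent_q_qint

lemma qint_nonzero: "m > 0 \<Longrightarrow> qint m \<noteq> 0"
  using q_power_neq_1[of "nat m"] by (simp add: qint_def power_int_def)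

lemma qint_0 [simp]: "qint 0 = 0"
  by (simp add: qint_def)

lemma qint_1 [simp]: "qint 1 = 1"
  by (simp add: qint_def)

section \<open>Gaussian binomial coefficients\<close>

text \<open>The falling q-factorial, the numerator of the Gaussian binomial. The upper argument is an integer
  so that it can be lowered without truncation at zero.\<close>

definition qfall :: "int \<Rightarrow> nat \<Rightarrow> ratfun" where
  "qfall m k = (\<Prod>j=1..k. qint (m - int j + 1))"

lemma qfall_0 [simp]: "qfall m 0 = 1"
  by (simp add: qfall_def)

lemma qfall_Suc: "qfall m (Suc k) = qfall m k * qint (m - int k)"
  by (simp add: qfall_def)

lemma qfall_Suc_left: "qfall m (Suc k) = qint m * qfall (m - 1) k"
proof (induction k)
  case (Suc k)
  then show ?case
    by (subst qfall_Suc) (simp add: qfall_Suc algebra_simps)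
qed (simp add: qfall_Suc)

abbreviation qfact :: "nat \<Rightarrow> ratfun" where
  "qfact k \<equiv> \<Prod>j=1..k. qint (int j)"

lemma qfact_nonzero: "qfact k \<noteq> 0"
  by (simp add: qint_nonzero)

lemma qbinom_qfall: "qbinom m k = qfall (int m) k / qfact k"
  by (simp add: qbinom_def qfall_def)

text \<open>The q-Pascal rule, from \<open>[m+1] = [k+1] + q\<^bsup>k+1\<^esup> [m-k]\<close>. For \<open>k > m\<close>
  both sides vanish, as the falling products contain the factor \<open>[0]\<close>.\<close>

lemma qbinom_Suc_Suc:
  "qbinom (Suc m) (Suc k) = qbinom m k + q powi (int k + 1) * qbinom m (Suc k)"
proof -
  have "qint (int m + 1) = qint (int k + 1) + q powi (int k + 1) * qint (int m - int k)"
    by (simp add: qint_def field_simps flip: power_int_add)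
  moreover have "qint (int k + 1) \<noteq> 0"
    by (simp add: qint_nonzero)
  ultimately show ?thesis
    using qfact_nonzero[of k]
    unfolding qbinom_qfall qfall_Suc_left[of "int (Suc m)"] qfall_Suc[of "int m"]
    by (simp add: field_simps)
qed

lemma Laurent_q_qbinom: "qbinom m k \<in> Laurent_q"
proof (induction m arbitrary: k)
  case 0
  show ?case
    by (cases k) (auto simp: qbinom_qfall qfall_Suc_left)
next
  case (Suc m)
  show ?case
  proof (cases k)
    case 0
    then show ?thesis
      by (simp add: qbinom_def)
  next
    case (Suc l)
    then show ?thesis
      by (auto simp only: qbinom_Suc_Suc intro!: Laurent_q_intros Suc.IH)
  qed
qed

lemma qbinom_eq_0: "m < k \<Longrightarrow> qbinom m k = 0"
proof -
  assume "m < k"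
  then have "qfall (int m) k = 0"
    unfolding qfall_def by (intro prod_zero bexI[of _ "Suc m"]) auto
  then show ?thesis
    by (simp add: qbinom_qfall)
qed

section \<open>The recurrence for the q-central Delannoy numbers\<close>

definition delannoy_term :: "nat \<Rightarrow> nat \<Rightarrow> ratfun" where
  "delannoy_term n k = q powi (int (k choose 2) - int k * int n) * qbinom n k * qbinom (n + k) k"

lemma Laurent_q_delannoy: "delannoy n \<in> Laurent_q"
  unfolding delannoy_def
  by (intro Laurent_q_sum Laurent_q_intros Laurent_q_qbinom)

text \<open>A common range of summation for the three terms of the recurrence.\<close>

lemma delannoy_extend: "n \<le> N \<Longrightarrow> delannoy n = (\<Sum>k\<le>N. delannoy_term n k)"
  unfolding delannoy_def delannoy_term_def
  by (intro sum.mono_neutral_left) (auto simp: qbinom_eq_0)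

text \<open>The next three lemmas are the hypergeometric term ratios of the summand. They are stated
  without division, so that they also hold for \<open>k > n\<close>, where the summand is zero. Here
  each of the two falling factorials is compared with its successor by peeling a factor off either
  end.\<close>

lemma delannoy_term_Suc_n:
  "qint (int n + int k + 1) * delannoy_term n k
     = q powi int k * qint (int n + 1 - int k) * delannoy_term (Suc n) k"
proof -
  have fall1: "qint (int n + 1) * qfall (int n) k = qfall (int n + 1) k * qint (int n + 1 - int k)"
    using qfall_Suc[of "int n + 1" k] qfall_Suc_left[of "int n + 1" k] by simp
  have fall2: "qint (int n + int k + 1) * qfall (int n + int k) k
      = qfall (int n + int k + 1) k * qint (int n + 1)"
    using qfall_Suc[of "int n + int k + 1" k] qfall_Suc_left[of "int n + int k + 1" k]
    by (simp add: algebra_simps)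
  have "qint (int n + 1) \<noteq> 0"
    by (simp add: qint_nonzero)
  moreover have "q powi (int (k choose 2) - int k * int n)
      = q powi int k * q powi (int (k choose 2) - int k * int (Suc n))"
    by (subst power_int_add[symmetric]) (simp_all add: algebra_simps)
  moreover have "qint (int n + 1) * (qint (int n + int k + 1) * (qfall (int n) k * qfall (int n + int k) k))
     = qint (int n + 1) * (qint (int n + 1 - int k) * (qfall (int n + 1) k * qfall (int n + int k + 1) k))"
    using fall1 fall2 by algebra
  ultimately show ?thesis
    using qfact_nonzero[of k]
    by (simp add: delannoy_term_def qbinom_qfall algebra_simps)
qed

lemma delannoy_term_Suc_k:
  "qint (int k + 1) ^ 2 * delannoy_term n (Suc k)
     = q powi (int k - int n) * qint (int n + int k + 1) * qint (int n - int k) * delannoy_term n k"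
proof -
  have "q powi (int (Suc k choose 2) - int (Suc k) * int n)
      = q powi (int k - int n) * q powi (int (k choose 2) - int k * int n)"
    by (simp add: algebra_simps numeral_2_eq_2 flip: power_int_add)
  moreover have "qint (int k + 1) \<noteq> 0"
    by (simp add: qint_nonzero)
  moreover have "qfall (int n + int k + 1) (Suc k) = qint (int n + int k + 1) * qfall (int n + int k) k"
    by (simp add: qfall_Suc_left)
  ultimately show ?thesis
    using qfact_nonzero[of k]
    by (simp add: delannoy_term_def qbinom_qfall qfall_Suc field_simps power2_eq_square)
qed

text \<open>The composite of the two steps, in which the factor \<open>[n+1-k]\<close> cancels. It ties \<open>t(n,n)\<close> to
  \<open>t(n+1,n+1)\<close>, whereas the intermediate \<open>t(n,n+1)\<close> is zero and carries no information.\<close>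

lemma delannoy_term_Suc_Suc:
  "q powi (int n + 1) * qint (int k + 1) ^ 2 * delannoy_term (Suc n) (Suc k)
     = qint (int n + int k + 1) * qint (int n + int k + 2) * delannoy_term n k"
proof -
  have "q powi (int n + 1) * qint (int k + 1) ^ 2 * delannoy_term (Suc n) (Suc k)
    = q powi (int n + 1) * q powi (int k - int n - 1) * qint (int n + int k + 2)
       * qint (int n + 1 - int k) * delannoy_term (Suc n) k"
    using delannoy_term_Suc_k[of k "Suc n"] by (simp add: algebra_simps)
  also have "q powi (int n + 1) * q powi (int k - int n - 1) = q powi int k"
    by (simp flip: power_int_add)
  finally show ?thesis
    using delannoy_term_Suc_n[of n k] by (simp add: algebra_simps)
qed

text \<open>The telescoping identity after substituting \<open>N = q\<^sup>n\<close> and \<open>x = q\<^sup>k\<close>. The terms \<open>T1\<close>, \<open>T0\<close> and \<open>S\<close>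
  stand for \<open>t(n+1,k)\<close>, \<open>t(n,k)\<close> and \<open>t(n+1,k-1)\<close>; all are polynomial multiples of one quantity \<open>h\<close>,
  namely \<open>T = t(n+2,k)\<close> over the denominators of the term ratios. After division by \<open>h\<close> the claim
  is an identity of polynomials of degree at most \<open>2\<close> in \<open>x\<close>. Its constant term determines \<open>c\<close>
  unless \<open>2 = 0\<close>, and this value satisfies the equations for the other two coefficients as well.\<close>

lemma rational_certificate:
  fixes q N x T T1 T0 S c a0 a1 a2 :: "'a::field"
  assumes [simp]: "q \<noteq> 0" "N \<noteq> 0"
    and nz: "1 - N * x * q \<noteq> 0" "1 - N * x * q ^ 2 \<noteq> 0"
    and T1: "(1 - N * x * q ^ 2) * T1 = (x - N * q ^ 2) * T"
    and T0: "(1 - N * x * q) * T0 = (x - N * q) * T1"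
    and S: "(1 - N * x * q) * (1 - N * x * q ^ 2) * S = N * q ^ 2 * (1 - x) ^ 2 * T"
    and a2: "a2 = (1 + N * q) * (1 - N * q ^ 2) / N"
    and a1: "a1 = (q + N * q ^ 2 + N ^ 2 * q ^ 4 + 3 * (N * q ^ 3)) * (1 - 1 / (N ^ 2 * q ^ 3))"
    and a0: "a0 = (1 + N * q ^ 2) * (1 - N * q) / N"
    and c: "c = - ((1 - N ^ 2 * q ^ 3) * (1 + N * q) * (1 + N * q ^ 2)) / (N ^ 2 * q ^ 2)"
  shows "a2 * T + a1 * T1 + a0 * T0 = c * (T1 - S)"
proof -
  define h where "h = T / ((1 - N * x * q) * (1 - N * x * q ^ 2))"
  have T': "T = (1 - N * x * q) * (1 - N * x * q ^ 2) * h"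
    using nz by (simp add: h_def)
  have T1': "T1 = (1 - N * x * q) * (x - N * q ^ 2) * h"
  proof -
    have "(1 - N * x * q ^ 2) * T1
        = (1 - N * x * q ^ 2) * ((1 - N * x * q) * (x - N * q ^ 2) * h)"
      using T1 unfolding T' by (simp only: ac_simps)
    then show ?thesis
      using nz by simp
  qed
  have T0': "T0 = (x - N * q) * (x - N * q ^ 2) * h"
  proof -
    have "(1 - N * x * q) * T0 = (1 - N * x * q) * ((x - N * q) * (x - N * q ^ 2) * h)"
      using T0 unfolding T1' by (simp only: ac_simps)
    then show ?thesis
      using nz by simp
  qed
  have S': "S = N * q ^ 2 * (1 - x) ^ 2 * h"
  proof -
    have "((1 - N * x * q) * (1 - N * x * q ^ 2)) * S
        = ((1 - N * x * q) * (1 - N * x * q ^ 2)) * (N * q ^ 2 * (1 - x) ^ 2 * h)"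
      using S unfolding T' by (simp only: ac_simps)
    then show ?thesis
      using nz by simp
  qed
  show ?thesis
    unfolding T' T1' T0' S' a2 a1 a0 c
    by (simp add: field_simps power2_eq_square power3_eq_cube power4_eq_xxxx)
qed

text \<open>The certificate is so simple because the usual Zeilberger companion \<open>G(n,k)\<close> is a multiple of
  \<open>t(n+1,k-1)\<close>, by a factor independent of \<open>k\<close>. It must vanish at \<open>k = 0\<close>, where natural-number
  subtraction would give \<open>t(n+1,0)\<close> instead; hence the case distinction.\<close>

lemma delannoy_term_telescope:
  fixes n k :: nat
  defines "c \<equiv> - ((1 - q powi (2 * int n + 3)) * (1 + q powi (int n + 1)) * (1 + q powi (int n + 2)))
                   / ((1 - q) * q powi (2 * int n + 2))"
  shows "q powi (- int n) * (1 + q powi (int n + 1)) * qint (int n + 2) * delannoy_term (n + 2) k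
    + (q + q powi (int n + 2) + q powi (2 * int n + 4) + 3 * q powi (int n + 3))
        * qint (- 2 * int n - 3) * delannoy_term (n + 1) k
    + q powi (- int n) * (1 + q powi (int n + 2)) * qint (int n + 1) * delannoy_term n k
    = c * (delannoy_term (n + 1) k - (if k = 0 then 0 else delannoy_term (n + 1) (k - 1)))"
proof -
  let ?a2 = "q powi (- int n) * (1 + q powi (int n + 1)) * qint (int n + 2)"
  let ?a1 = "(q + q powi (int n + 2) + q powi (2 * int n + 4) + 3 * q powi (int n + 3))
    * qint (- 2 * int n - 3)"
  let ?a0 = "q powi (- int n) * (1 + q powi (int n + 2)) * qint (int n + 1)"
  let ?T2 = "delannoy_term (n + 2) k" and ?T1 = "delannoy_term (n + 1) k"
  let ?T0 = "delannoy_term n k" and ?S = "if k = 0 then 0 else delannoy_term (n + 1) (k - 1)"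
  have nz: "1 - q ^ n * q ^ k * q \<noteq> 0" "1 - q ^ n * q ^ k * q ^ 2 \<noteq> 0"
    using q_power_neq_1[of "n + k + 1"] q_power_neq_1[of "n + k + 2"]
    by (simp_all add: power_add power2_eq_square mult.commute mult.left_commute)
  have T1: "(1 - q ^ n * q ^ k * q ^ 2) * ?T1 = (q ^ k - q ^ n * q ^ 2) * ?T2"
    using delannoy_term_Suc_n[of "n + 1" k]
    by (simp add: qint_def power_int_diff power_int_add power2_eq_square algebra_simps)
  have T0: "(1 - q ^ n * q ^ k * q) * ?T0 = (q ^ k - q ^ n * q) * ?T1"
    using delannoy_term_Suc_n[of n k]
    by (simp add: qint_def power_int_diff power_int_add power2_eq_square algebra_simps)
  have S: "(1 - q ^ n * q ^ k * q) * (1 - q ^ n * q ^ k * q ^ 2) * ?S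
      = q ^ n * q ^ 2 * (1 - q ^ k) ^ 2 * ?T2"
  proof (cases k)
    case (Suc j)
    have eqs: "1 - q ^ k = (1 - q) * qint (int k)"
      "1 - q ^ n * q ^ k * q = (1 - q) * qint (int n + int k + 1)"
      "1 - q ^ n * q ^ k * q ^ 2 = (1 - q) * qint (int n + int k + 2)"
      by (simp_all add: qint_def power_int_add)
    have "q ^ n * q ^ 2 * qint (int k) ^ 2 * ?T2
        = qint (int n + int k + 1) * qint (int n + int k + 2) * ?S"
      using delannoy_term_Suc_Suc[of "n + 1" j]
      by (simp add: Suc power_int_add power2_eq_square mult.assoc add_ac)
    then have "(1 - q) ^ 2 * (q ^ n * q ^ 2 * qint (int k) ^ 2 * ?T2)
        = (1 - q) ^ 2 * (qint (int n + int k + 1) * qint (int n + int k + 2) * ?S)"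
      by (rule arg_cong)
    then show ?thesis
      unfolding eqs
      by (simp only: power2_eq_square mult.assoc) (simp only: mult.left_commute mult.commute)
  qed simp
  have double: "q powi (2 * int n) = (q ^ n) ^ 2"
    using power_int_add[of q "int n" "int n"] by (simp add: power2_eq_square)
  \<comment> \<open>The factor \<open>1 - q\<close> clears the denominator of the q-integer in each coefficient.\<close>
  have "((1 - q) * ?a2) * ?T2 + ((1 - q) * ?a1) * ?T1 + ((1 - q) * ?a0) * ?T0
      = ((1 - q) * c) * (?T1 - ?S)"
  proof (rule rational_certificate[OF _ _ nz T1 T0 S])
    show "(1 - q) * ?a2 = (1 + q ^ n * q) * (1 - q ^ n * q ^ 2) / q ^ n"
      by (simp add: qint_def power_int_add power_int_minus divide_simps)
    show "(1 - q) * ?a1 = (q + q ^ n * q ^ 2 + (q ^ n) ^ 2 * q ^ 4 + 3 * (q ^ n * q ^ 3))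
        * (1 - 1 / ((q ^ n) ^ 2 * q ^ 3))"
    proof -
      have "q powi (- 2 * int n - 3) = inverse (q powi (2 * int n + 3))"
        using power_int_minus[of q "2 * int n + 3"]
        by (simp only: minus_add_distrib minus_mult_left diff_conv_add_uminus)
      then have "q powi (- 2 * int n - 3) = 1 / ((q ^ n) ^ 2 * q ^ 3)"
        by (simp add: power_int_add double inverse_eq_divide)
      moreover have "q powi (2 * int n + 4) = (q ^ n) ^ 2 * q ^ 4"
        by (simp add: power_int_add double)
      moreover have "q powi (int n + 2) = q ^ n * q ^ 2" "q powi (int n + 3) = q ^ n * q ^ 3"
        by (simp_all add: power_int_add)
      moreover have "(1 - q) * (a * qint m) = a * (1 - q powi m)" for a m
        by (simp add: qint_def)
      ultimately show ?thesis
        by (simp only:)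
    qed
    show "(1 - q) * ?a0 = (1 + q ^ n * q ^ 2) * (1 - q ^ n * q) / q ^ n"
      by (simp add: qint_def power_int_add power_int_minus divide_simps)
    show "(1 - q) * c = - ((1 - (q ^ n) ^ 2 * q ^ 3) * (1 + q ^ n * q) * (1 + q ^ n * q ^ 2))
        / ((q ^ n) ^ 2 * q ^ 2)"
      by (simp add: c_def power_int_add double)
  qed simp_all
  then have "(1 - q) * (?a2 * ?T2 + ?a1 * ?T1 + ?a0 * ?T0) = (1 - q) * (c * (?T1 - ?S))"
    by (simp only: distrib_left mult.assoc)
  then show ?thesis
    by simp
qed

text \<open>The telescoped identity is summed over \<open>k \<le> n + 2\<close>, which covers the supports of all three
  summands; the upper boundary term is zero because \<open>t(n+1,n+2) = 0\<close>.\<close>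

lemma delannoy_recurrence:
  "q powi (- int n) * (1 + q powi (int n + 1)) * qint (int n + 2) * delannoy (n + 2)
    + (q + q powi (int n + 2) + q powi (2 * int n + 4) + 3 * q powi (int n + 3))
        * qint (- 2 * int n - 3) * delannoy (n + 1)
    + q powi (- int n) * (1 + q powi (int n + 2)) * qint (int n + 1) * delannoy n = 0"
    (is "?a2 * _ + ?a1 * _ + ?a0 * _ = 0")
proof -
  let ?g = "\<lambda>k. if k = 0 then 0 else delannoy_term (n + 1) (k - 1)"
  obtain c where c: "\<And>k. ?a2 * delannoy_term (n + 2) k + ?a1 * delannoy_term (n + 1) k
      + ?a0 * delannoy_term n k = c * (delannoy_term (n + 1) k - ?g k)"
    by (rule that[OF delannoy_term_telescope])
  have "?a2 * delannoy (n + 2) + ?a1 * delannoy (n + 1) + ?a0 * delannoy n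
      = (\<Sum>k\<le>n + 2. ?a2 * delannoy_term (n + 2) k + ?a1 * delannoy_term (n + 1) k
           + ?a0 * delannoy_term n k)"
    using delannoy_extend[of "n + 2" "n + 2"] delannoy_extend[of "n + 1" "n + 2"]
      delannoy_extend[of n "n + 2"]
    by (simp only: sum.distrib sum_distrib_left)
  also have "\<dots> = c * (?g (Suc (n + 2)) - ?g 0)"
    unfolding c sum_distrib_left[symmetric] using sum_lessThan_telescope[of ?g "Suc (n + 2)"]
    by (simp add: lessThan_Suc_atMost del: sum.atMost_Suc)
  also have "?g (Suc (n + 2)) = 0"
    by (simp add: delannoy_term_def qbinom_eq_0)
  finally show ?thesis
    by simp
qed

section \<open>Summation by parts\<close>

text \<open>Summation by parts for a second-order operator annihilating \<open>F\<close>. The condition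
  \<open>a1 (-1) F 0 + a2 (-1) F 1 = 0\<close> is the recurrence at \<open>-1\<close> without the term in \<open>F (-1)\<close>; it removes the
  boundary terms at the lower end. At the upper end the recurrence has been used once more, to trade
  the coefficients \<open>a1 n\<close> and \<open>a2 n\<close> for \<open>a0 n\<close>.\<close>

lemma sum_adjoint_apply:
  assumes rec: "\<And>n::nat. a0 (int n) * F n + a1 (int n) * F (n + 1) + a2 (int n) * F (n + 2) = 0"
    and bdry: "a2 (- 2) = 0" "a1 (- 1) * F 0 + a2 (- 1) * F 1 = 0"
  shows "(\<Sum>k=0..<Suc n. adjoint_apply [a0, a1, a2] P (int k) * F k)
    = a0 (int n) * P (int n) * F n - a2 (int n - 1) * P (int n - 1) * F (n + 1)"
proof (induction n)
  case 0
  have "a1 (- 1) * P (- 1) * F 0 = - (a2 (- 1) * P (- 1) * F 1)"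
    using bdry(2) by algebra
  then show ?case
    by (simp add: adjoint_apply_def numeral_3_eq_3 bdry(1) algebra_simps)
next
  case (Suc n)
  have "adjoint_apply [a0, a1, a2] P (int (Suc n))
      = a0 (int (Suc n)) * P (int (Suc n)) + a1 (int n) * P (int n) + a2 (int n - 1) * P (int n - 1)"
    by (simp add: adjoint_apply_def numeral_3_eq_3)
  moreover have "P (int n) * (a0 (int n) * F n + a1 (int n) * F (n + 1) + a2 (int n) * F (n + 2)) = 0"
    using rec by simp
  ultimately show ?case
    unfolding sum.atLeast0_lessThan_Suc[of _ "Suc n"] Suc.IH
    by (simp add: algebra_simps)
qed

text \<open>Being defined at \<open>0\<close> excludes negative powers of \<open>x\<close>, whose values would in general not be
  Laurent polynomials in \<open>q\<close>.\<close>

lemma Laurent_q_laurent_eval: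
  assumes "\<And>i. Poly_Mapping.lookup p i \<in> Laurent_q" "laurent_defined_at p 0" "x \<in> Laurent_q"
  shows "laurent_eval p x \<in> Laurent_q"
  unfolding laurent_eval_def
proof (intro Laurent_q_sum Laurent_q_mult assms)
  fix i assume "i \<in> Poly_Mapping.keys p"
  with assms(2) have "i \<ge> 0"
    by (simp add: laurent_defined_at_def)
  then show "x powi i \<in> Laurent_q"
    by (simp add: power_int_def Laurent_q_power assms(3))
qed

theorem corollary7:
  fixes \<epsilon> :: ratfun and n :: nat and p :: "int \<Rightarrow>\<^sub>0 ratfun"
  assumes "\<epsilon> \<in> {1, -1}"
    and "n > 0"
    and "\<And>i. Poly_Mapping.lookup p i \<in> Laurent_q"
    and "\<And>k i. k < n \<Longrightarrow> i < length (delannoy_operator \<epsilon>)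
           \<Longrightarrow> laurent_defined_at p (qint (int k - int i))"
  shows "laurent_cong
     (\<Sum>k=0..<n. adjoint_apply (delannoy_operator \<epsilon>) (\<lambda>j. laurent_eval p (qint j)) (int k)
        * \<epsilon> ^ k * delannoy k)
     0 (qint (int n))"
proof -
  obtain m where n: "n = Suc m"
    using assms(2) by (cases n) auto
  have sq: "\<epsilon> * \<epsilon> = 1"
    using assms(1) by auto
  have \<epsilon>: "\<epsilon> \<in> Laurent_q"
    using assms(1) by (auto intro: Laurent_q_uminus)
  define P where "P j = laurent_eval p (qint j)" for j
  define F where "F k = \<epsilon> ^ k * delannoy k" for k
  \<comment> \<open>The summand \<open>k = 0\<close> evaluates \<open>p\<close> at \<open>[0] = 0\<close>, so \<open>p\<close> is a polynomial in \<open>x\<close>.\<close>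
  have P: "P j \<in> Laurent_q" for j
    unfolding P_def using assms(3) assms(4)[of 0 0] \<open>n > 0\<close>
    by (intro Laurent_q_laurent_eval) (simp_all add: delannoy_operator_def Laurent_q_qint)
  have F: "F k \<in> Laurent_q" for k
    by (simp add: F_def Laurent_q_mult Laurent_q_power Laurent_q_delannoy \<epsilon>)
  define a0 where "a0 = (\<lambda>k. q powi (-k) * (1 + q powi (k + 2)) * qint (k + 1))"
  define a1 where "a1 = (\<lambda>k. \<epsilon> * (q + q powi (k + 2) + q powi (2 * k + 4) + 3 * q powi (k + 3))
      * qint (- 2 * k - 3))"
  define a2 where "a2 = (\<lambda>k. q powi (-k) * (1 + q powi (k + 1)) * qint (k + 2))"
  have L: "delannoy_operator \<epsilon> = [a0, a1, a2]"
    by (simp add: delannoy_operator_def a0_def a1_def a2_def)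
  \<comment> \<open>The sign in the middle coefficient compensates the twist by \<open>\<epsilon>\<^sup>k\<close>, as \<open>\<epsilon>\<^sup>2 = 1\<close>.\<close>
  have rec: "a0 (int k) * F k + a1 (int k) * F (k + 1) + a2 (int k) * F (k + 2) = 0" for k
  proof -
    have "a0 (int k) * F k + a1 (int k) * F (k + 1) + a2 (int k) * F (k + 2)
      = \<epsilon> ^ k * (a2 (int k) * (\<epsilon> * \<epsilon>) * delannoy (k + 2)
        + (q + q powi (int k + 2) + q powi (2 * int k + 4) + 3 * q powi (int k + 3))
            * qint (- 2 * int k - 3) * (\<epsilon> * \<epsilon>) * delannoy (k + 1) + a0 (int k) * delannoy k)"
      unfolding F_def a1_def by (simp only: power_add power_one_right power2_eq_square) algebra
    also have "\<dots> = 0"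
      using delannoy_recurrence[of k] by (simp add: sq a0_def a2_def)
    finally show ?thesis .
  qed
  have bdry: "a1 (- 1) * F 0 + a2 (- 1) * F 1 = 0"
  proof -
    have D: "delannoy 0 = 1" "delannoy 1 = 1 + inverse q * (1 + q)"
      using qint_of_nat[of 2]
      by (simp_all add: delannoy_def qbinom_def power_int_minus numeral_2_eq_2)
    have "qint (- 1) = - inverse q"
      using qint_neg[of 1] by (simp add: power_int_minus)
    then show ?thesis
      by (simp add: a1_def a2_def F_def D field_simps power2_eq_square qint_def del: One_nat_def)
  qed
  have "(\<Sum>k=0..<n. adjoint_apply (delannoy_operator \<epsilon>) P (int k) * \<epsilon> ^ k * delannoy k)
      = (\<Sum>k=0..<Suc m. adjoint_apply [a0, a1, a2] P (int k) * F k)"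
    by (simp only: n L F_def mult.assoc)
  also have "\<dots> = a0 (int m) * P (int m) * F m - a2 (int m - 1) * P (int m - 1) * F (m + 1)"
    by (intro sum_adjoint_apply rec bdry) (simp add: a2_def)
  also have "\<dots> = qint (int n) * (q powi (- int m) * (1 + q powi (int m + 2)) * P (int m) * F m
      + - (q powi (1 - int m) * (1 + q powi int m) * P (int m - 1) * F (m + 1)))"
    (is "_ = _ * ?c")
    by (simp add: a0_def a2_def n algebra_simps)
  finally have "(\<Sum>k=0..<n. adjoint_apply (delannoy_operator \<epsilon>) P (int k) * \<epsilon> ^ k * delannoy k) - 0
      = qint (int n) * ?c"
    by simp
  moreover have "?c \<in> Laurent_q"
    by (intro Laurent_q_intros Laurent_q_1 P F)
  ultimately show ?thesis
    unfolding laurent_cong_def P_def[abs_def] by blast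
qed

end
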